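(* The Burau representation of the Artin--Tits group of affine type $\tilde{A}_3$ is not faithful; that is, the group homomorphism $\mathbf{B}(\tilde{A}_3)\to GL(V_{q,\tilde{A}_3})$ has non-trivial kernel.
   Context: The Coxeter diagram $\Gamma=\tilde{A}_3$ is the 4-cycle: vertices $1,2,3,4$, with $i$ adjacent to $i+1$ (indices modulo $4$), all edges labelled $3$. Its Artin--Tits group $\mathbf{B}(\Gamma)$ is the group generated by $\sigma_1,\sigma_2,\sigma_3,\sigma_4$ with relations $\sigma_i\sigma_j\sigma_i=\sigma_j\sigma_i\sigma_j$ if $i,j$ are adjacent and $\sigma_i\sigma_j=\sigma_j\sigma_i$ if $i\ne j$ are not adjacent. Burau representation: $V_{q,\Gamma}$ is the $\mathbb{C}(q)$-vector space with basis $\alpha_1,\dots,\alpha_4$. It carries the pairing given on the basis by $\langle\alpha_i,\alpha_i\rangle=1+q^2$, $\langle\alpha_i,\alpha_j\rangle=q$ if $i,j$ are adjacent, and $\langle\alpha_i,\alpha_j\rangle=0$ if $i\neq j$ are not adjacent, extended so that $\langle qx,y\rangle=q^{-1}\langle x,y\rangle$ and $\langle x,qy\rangle=q\langle x,y\rangle$. The group $\mathbf{B}(\Gamma)$ acts $\mathbb{C}(q)$-linearly on $V_{q,\Gamma}$ by $\sigma_i(\alpha_j)=\alpha_j-\langle\alpha_i,\alpha_j\rangle\alpha_i$. *)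

theory Defs
  imports
    "HOL-Algebra.Coset"
    "HOL-Analysis.Cartesian_Space"
    "HOL-Computational_Algebra.Polynomial_Factorial"
    "HOL-Computational_Algebra.Field_as_Ring"
    "HOL-Library.Numeral_Type"
begin

section \<open>Groups given by generators and relations\<close>

text \<open>
  A letter \<open>(g, True)\<close> stands for the generator \<open>g\<close>, and \<open>(g, False)\<close> for its inverse.
  A relation \<open>u = v\<close> is the pair \<open>(u, v)\<close> of words.
\<close>

type_synonym 'g word = "('g \<times> bool) list"

inductive pres_eq :: "('g word \<times> 'g word) set \<Rightarrow> 'g word \<Rightarrow> 'g word \<Rightarrow> bool"
  for R :: "('g word \<times> 'g word) set" where
  refl: "pres_eq R u u"
| sym: "pres_eq R u v \<Longrightarrow> pres_eq R v u"
| trans: "pres_eq R u v \<Longrightarrow> pres_eq R v w \<Longrightarrow> pres_eq R u w"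
| append: "pres_eq R u u' \<Longrightarrow> pres_eq R v v' \<Longrightarrow> pres_eq R (u @ v) (u' @ v')"
| cancel: "pres_eq R [(g, b), (g, \<not> b)] []"
| relation: "(u, v) \<in> R \<Longrightarrow> pres_eq R u v"

definition word_class :: "('g word \<times> 'g word) set \<Rightarrow> 'g word \<Rightarrow> 'g word set" where
  "word_class R u = {v. pres_eq R u v}"

definition presented_group :: "('g word \<times> 'g word) set \<Rightarrow> 'g word set monoid" where
  "presented_group R =
     \<lparr>carrier = range (word_class R),
      monoid.mult = (\<lambda>X Y. \<Union>x\<in>X. \<Union>y\<in>Y. word_class R (x @ y)),
      one = word_class R []\<rparr>"

definition pres_gen :: "('g word \<times> 'g word) set \<Rightarrow> 'g \<Rightarrow> 'g word set" where
  "pres_gen R g = word_class R [(g, True)]"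

definition eval_letter :: "('h, 'm) monoid_scheme \<Rightarrow> ('g \<Rightarrow> 'h) \<Rightarrow> 'g \<times> bool \<Rightarrow> 'h" where
  "eval_letter H f l = (if snd l then f (fst l) else inv\<^bsub>H\<^esub> (f (fst l)))"

definition eval_word :: "('h, 'm) monoid_scheme \<Rightarrow> ('g \<Rightarrow> 'h) \<Rightarrow> 'g word \<Rightarrow> 'h" where
  "eval_word H f u = foldr (\<lambda>l x. eval_letter H f l \<otimes>\<^bsub>H\<^esub> x) u \<one>\<^bsub>H\<^esub>"

text \<open>
  The homomorphism to \<open>H\<close> extending \<open>f\<close> on generators. It is meaningful when \<open>f\<close> respects the
  relations, for then all words of a class have the same value.
\<close>

definition pres_lift :: "('h, 'm) monoid_scheme \<Rightarrow> ('g \<Rightarrow> 'h) \<Rightarrow> 'g word set \<Rightarrow> 'h" where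
  "pres_lift H f X = the_elem (eval_word H f ` X)"

lemma word_class_eq_iff: "word_class R u = word_class R v \<longleftrightarrow> pres_eq R u v"
proof
  assume "word_class R u = word_class R v"
  then have "v \<in> word_class R u" by (simp add: word_class_def pres_eq.refl)
  then show "pres_eq R u v" by (simp add: word_class_def)
next
  assume "pres_eq R u v"
  then have "pres_eq R u w \<longleftrightarrow> pres_eq R v w" for w
    by (meson pres_eq.sym pres_eq.trans)
  then show "word_class R u = word_class R v" by (simp add: word_class_def)
qed

lemma mult_word_class:
  "word_class R u \<otimes>\<^bsub>presented_group R\<^esub> word_class R v = word_class R (u @ v)"
proof -
  have eq: "word_class R (x @ y) = word_class R (u @ v)"
    if "x \<in> word_class R u" "y \<in> word_class R v" for x y
    unfolding word_class_eq_iff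
    by (rule pres_eq.sym, rule pres_eq.append) (use that in \<open>simp_all add: word_class_def\<close>)
  have "u \<in> word_class R u" "v \<in> word_class R v"
    by (auto simp: word_class_def intro: pres_eq.refl)
  then have ne: "word_class R u \<noteq> {}" "word_class R v \<noteq> {}"
    by auto
  have "word_class R u \<otimes>\<^bsub>presented_group R\<^esub> word_class R v
      = (\<Union>x\<in>word_class R u. \<Union>y\<in>word_class R v. word_class R (u @ v))"
    unfolding presented_group_def monoid.simps by (intro SUP_cong HOL.refl eq)
  also have "\<dots> = word_class R (u @ v)"
    using ne by simp
  finally show ?thesis .
qed

lemma pres_eq_cancel_word:
  "pres_eq R (rev (map (\<lambda>(g, b). (g, \<not> b)) u) @ u) []"
proof (induction u)
  case Nil
  show ?case by (simp add: pres_eq.refl)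
next
  case (Cons l u)
  obtain g b where l: "l = (g, b)" by force
  let ?v = "rev (map (\<lambda>(g, b). (g, \<not> b)) u)"
  have "pres_eq R [(g, \<not> b), (g, b)] []"
    using pres_eq.cancel[of R g "\<not> b"] by simp
  then have "pres_eq R (?v @ ([(g, \<not> b), (g, b)] @ u)) (?v @ ([] @ u))"
    by (intro pres_eq.append pres_eq.refl)
  from pres_eq.trans[OF this] Cons.IH show ?case
    by (simp add: l)
qed

lemma group_presented_group: "group (presented_group R)"
proof (rule groupI)
  show "\<exists>y\<in>carrier (presented_group R). y \<otimes>\<^bsub>presented_group R\<^esub> x = \<one>\<^bsub>presented_group R\<^esub>"
    if "x \<in> carrier (presented_group R)" for x
  proof -
    obtain u where "x = word_class R u"
      using \<open>x \<in> _\<close> by (auto simp: presented_group_def)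
    then have "word_class R (rev (map (\<lambda>(g, b). (g, \<not> b)) u)) \<otimes>\<^bsub>presented_group R\<^esub> x
        = \<one>\<^bsub>presented_group R\<^esub>"
      by (simp add: mult_word_class)
        (simp add: presented_group_def word_class_eq_iff pres_eq_cancel_word)
    then show ?thesis by (auto simp: presented_group_def)
  qed
next
  have one: "\<one>\<^bsub>presented_group R\<^esub> = word_class R []"
    by (simp add: presented_group_def)
  have car: "carrier (presented_group R) = range (word_class R)"
    by (simp add: presented_group_def)
  show "x \<otimes>\<^bsub>presented_group R\<^esub> y \<in> carrier (presented_group R)"
    if "x \<in> carrier (presented_group R)" "y \<in> carrier (presented_group R)" for x y
    using that by (auto simp: car mult_word_class)
  show "\<one>\<^bsub>presented_group R\<^esub> \<in> carrier (presented_group R)"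
    by (simp add: car one)
  show "x \<otimes>\<^bsub>presented_group R\<^esub> y \<otimes>\<^bsub>presented_group R\<^esub> z
      = x \<otimes>\<^bsub>presented_group R\<^esub> (y \<otimes>\<^bsub>presented_group R\<^esub> z)"
    if "x \<in> carrier (presented_group R)" "y \<in> carrier (presented_group R)"
      "z \<in> carrier (presented_group R)" for x y z
    using that by (auto simp: car mult_word_class)
  show "\<one>\<^bsub>presented_group R\<^esub> \<otimes>\<^bsub>presented_group R\<^esub> x = x"
    if "x \<in> carrier (presented_group R)" for x
    using that by (auto simp: car one mult_word_class)
qed

context group
begin

lemma eval_letter_closed:
  assumes "\<And>g. f g \<in> carrier G"
  shows "eval_letter G f l \<in> carrier G"
  using assms by (simp add: eval_letter_def)

lemma eval_word_closed:
  assumes "\<And>g. f g \<in> carrier G"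
  shows "eval_word G f u \<in> carrier G"
  by (induction u) (simp_all add: eval_word_def eval_letter_closed assms)

lemma eval_word_append:
  assumes "\<And>g. f g \<in> carrier G"
  shows "eval_word G f (u @ v) = eval_word G f u \<otimes> eval_word G f v"
proof (induction u)
  case Nil
  then show ?case using eval_word_closed[of f v, OF assms] by (simp add: eval_word_def)
next
  case (Cons l u)
  then show ?case
    using eval_word_closed[of f u, OF assms] eval_word_closed[of f v, OF assms]
      eval_letter_closed[of f l, OF assms]
    by (simp add: eval_word_def m_assoc)
qed

lemma eval_word_pres_eq:
  assumes f: "\<And>g. f g \<in> carrier G"
    and R: "\<And>u v. (u, v) \<in> R \<Longrightarrow> eval_word G f u = eval_word G f v"
    and "pres_eq R u v"
  shows "eval_word G f u = eval_word G f v"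
  using assms(3)
proof induction
  case (cancel g b)
  show ?case using f by (cases b) (simp_all add: eval_word_def eval_letter_def)
next
  case (append u u' v v')
  then show ?case by (simp only: eval_word_append[of f, OF f])
next
  case (relation u v)
  then show ?case by (rule R)
qed simp_all

lemma pres_lift_word_class:
  assumes f: "\<And>g. f g \<in> carrier G"
    and R: "\<And>u v. (u, v) \<in> R \<Longrightarrow> eval_word G f u = eval_word G f v"
  shows "pres_lift G f (word_class R u) = eval_word G f u"
proof -
  have "eval_word G f ` word_class R u = {eval_word G f u}"
  proof
    show "eval_word G f ` word_class R u \<subseteq> {eval_word G f u}"
    proof
      fix x
      assume "x \<in> eval_word G f ` word_class R u"
      then obtain v where v: "pres_eq R u v" "x = eval_word G f v"
        by (auto simp: word_class_def)
      show "x \<in> {eval_word G f u}"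
        using eval_word_pres_eq[of f R u v, OF f R v(1)] v(2) by simp
    qed
    show "{eval_word G f u} \<subseteq> eval_word G f ` word_class R u"
      by (simp add: word_class_def pres_eq.refl)
  qed
  then show ?thesis by (simp add: pres_lift_def)
qed

lemma pres_lift_hom:
  assumes f: "\<And>g. f g \<in> carrier G"
    and R: "\<And>u v. (u, v) \<in> R \<Longrightarrow> eval_word G f u = eval_word G f v"
  shows "pres_lift G f \<in> hom (presented_group R) G"
    and "pres_lift G f (pres_gen R g) = f g"
proof -
  note lift = pres_lift_word_class[of f R, OF f R]
  show "pres_lift G f \<in> hom (presented_group R) G"
  proof (rule homI)
    show "pres_lift G f x \<in> carrier G" if "x \<in> carrier (presented_group R)" for x
      using that eval_word_closed[of f, OF f] by (auto simp: presented_group_def lift)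
    show "pres_lift G f (x \<otimes>\<^bsub>presented_group R\<^esub> y) = pres_lift G f x \<otimes> pres_lift G f y"
      if "x \<in> carrier (presented_group R)" "y \<in> carrier (presented_group R)" for x y
    proof -
      obtain u v where "x = word_class R u" "y = word_class R v"
        using \<open>x \<in> _\<close> \<open>y \<in> _\<close> by (auto simp: presented_group_def)
      then show ?thesis by (simp add: mult_word_class lift eval_word_append[of f, OF f])
    qed
  qed
  show "pres_lift G f (pres_gen R g) = f g"
    using f by (simp add: pres_gen_def lift) (simp add: eval_word_def eval_letter_def)
qed

end


section \<open>The Artin--Tits group of affine type \<open>A\<^sub>3\<close>\<close>

text \<open>
  The vertices of the diagram are the elements of the type \<open>4\<close> of integers modulo 4; the vertex
  labelled 4 is therefore \<open>0\<close>.
\<close>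

definition adjacent :: "4 \<Rightarrow> 4 \<Rightarrow> bool" where
  "adjacent i j \<longleftrightarrow> j = i + 1 \<or> i = j + 1"

definition artin_relations :: "(4 word \<times> 4 word) set" where
  "artin_relations =
     {([(i, True), (j, True), (i, True)], [(j, True), (i, True), (j, True)]) | i j. adjacent i j} \<union>
     {([(i, True), (j, True)], [(j, True), (i, True)]) | i j. i \<noteq> j \<and> \<not> adjacent i j}"

definition artin_group :: "4 word set monoid" where
  "artin_group = presented_group artin_relations"

definition artin_gen :: "4 \<Rightarrow> 4 word set" where
  "artin_gen = pres_gen artin_relations"


section \<open>The Burau representation\<close>

type_synonym ratfun = "complex poly fract"

definition q :: ratfun where
  "q = to_fract [:0, 1:]"

definition subst_inv_q :: "complex poly \<Rightarrow> ratfun" where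
  "subst_inv_q p = poly (map_poly (\<lambda>c. to_fract [:c:]) p) (inverse q)"

text \<open>The automorphism of the field of rational functions fixing constants with \<open>q \<mapsto> q\<inverse>\<close>.\<close>

definition bar :: "ratfun \<Rightarrow> ratfun" where
  "bar x = (case quot_of_fract x of (a, b) \<Rightarrow> subst_inv_q a / subst_inv_q b)"

definition simple_root :: "4 \<Rightarrow> ratfun ^ 4" where
  "simple_root i = axis i 1"

definition gram :: "4 \<Rightarrow> 4 \<Rightarrow> ratfun" where
  "gram i j = (if i = j then 1 + q\<^sup>2 else if adjacent i j then q else 0)"

definition pairing :: "ratfun ^ 4 \<Rightarrow> ratfun ^ 4 \<Rightarrow> ratfun" where
  "pairing x y = (\<Sum>i\<in>UNIV. \<Sum>j\<in>UNIV. bar (x $ i) * (y $ j) * gram i j)"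

definition burau_gen :: "4 \<Rightarrow> ratfun ^ 4 \<Rightarrow> ratfun ^ 4" where
  "burau_gen i v = v - pairing (simple_root i) v *s simple_root i"

definition GL_V :: "(ratfun ^ 4 \<Rightarrow> ratfun ^ 4) monoid" where
  "GL_V = \<lparr>carrier = {f. Vector_Spaces.linear (*s) (*s) f \<and> bij f}, monoid.mult = (\<circ>), one = id\<rparr>"

definition burau :: "4 word set \<Rightarrow> ratfun ^ 4 \<Rightarrow> ratfun ^ 4" where
  "burau = pres_lift GL_V burau_gen"


subsection \<open>The pairing is the sesquilinear extension of its values on the basis\<close>

lemma q_nonzero [simp]: "q \<noteq> 0"
  by (simp add: q_def)

lemma subst_inv_q_0 [simp]: "subst_inv_q 0 = 0"
  by (simp add: subst_inv_q_def)

lemma subst_inv_q_pCons: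
  "subst_inv_q (pCons a p) = to_fract [:a:] + inverse q * subst_inv_q p"
  by (cases "a = 0 \<and> p = 0") (auto simp: subst_inv_q_def map_poly_pCons)

lemma subst_inv_q_1 [simp]: "subst_inv_q 1 = 1"
  by (simp add: one_pCons subst_inv_q_pCons) (simp flip: one_pCons)

lemma subst_inv_q_add: "subst_inv_q (p + r) = subst_inv_q p + subst_inv_q r"
proof (induction p r rule: poly_induct2)
  case (pCons a p b r)
  have "to_fract [:a + b:] = to_fract [:a:] + to_fract [:b:]"
    by (simp flip: to_fract_add)
  with pCons show ?case by (simp add: subst_inv_q_pCons algebra_simps)
qed simp

lemma subst_inv_q_smult: "subst_inv_q (smult c p) = to_fract [:c:] * subst_inv_q p"
proof (induction p)
  case (pCons a p)
  have "to_fract [:c * a:] = to_fract [:c:] * to_fract [:a:]"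
    by (simp flip: to_fract_mult)
  with pCons show ?case by (simp add: subst_inv_q_pCons algebra_simps)
qed simp

lemma subst_inv_q_mult: "subst_inv_q (p * r) = subst_inv_q p * subst_inv_q r"
  by (induction p)
    (simp_all add: subst_inv_q_pCons subst_inv_q_add subst_inv_q_smult algebra_simps)

lemma poly_map_poly_q: "poly (map_poly (\<lambda>c. to_fract [:c:]) p) q = to_fract p"
proof (induction p)
  case (pCons a p)
  have "pCons a p = [:a:] + [:0, 1:] * p" by simp
  then have "to_fract (pCons a p) = to_fract [:a:] + q * to_fract p"
    by (simp only: to_fract_add to_fract_mult q_def)
  with pCons show ?case by (simp add: map_poly_pCons)
qed simp

lemma subst_inv_q_eq_0_iff [simp]: "subst_inv_q p = 0 \<longleftrightarrow> p = 0"
proof -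
  let ?P = "map_poly (\<lambda>c. to_fract [:c:]) p"
  have "degree ?P = degree p" by (intro degree_map_poly) simp
  then have "reflect_poly ?P = map_poly (\<lambda>c. to_fract [:c:]) (reflect_poly p)"
    by (intro poly_eqI) (simp add: coeff_reflect_poly coeff_map_poly)
  then have "to_fract (reflect_poly p) = q ^ degree ?P * subst_inv_q p"
    using poly_reflect_poly_nz[of q ?P] by (simp add: poly_map_poly_q subst_inv_q_def)
  then have "reflect_poly p = 0" if "subst_inv_q p = 0"
    using that by (metis mult_zero_right to_fract_eq_0_iff)
  then show ?thesis by auto
qed

lemma bar_divide:
  assumes "b \<noteq> 0"
  shows "bar (to_fract a / to_fract b) = subst_inv_q a / subst_inv_q b"
proof -
  obtain c d where cd: "quot_of_fract (to_fract a / to_fract b) = (c, d)" by force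
  then have d: "d \<noteq> 0" by (metis snd_conv snd_quot_of_fract_nonzero)
  have "to_fract c / to_fract d = to_fract a / to_fract b"
    using Fract_quot_of_fract[of "to_fract a / to_fract b"] cd by (simp add: Fract_conv_to_fract)
  then have "to_fract (c * b) = to_fract (a * d)"
    using assms d by (simp add: field_simps)
  then have "subst_inv_q c * subst_inv_q b = subst_inv_q a * subst_inv_q d"
    unfolding to_fract_eq_iff by (metis subst_inv_q_mult)
  then show ?thesis using cd assms d by (simp add: bar_def field_simps)
qed

lemma ratfun_cases:
  obtains a b where "x = to_fract a / to_fract b" "b \<noteq> (0 :: complex poly)"
  using Fract_quot_of_fract[of x] snd_quot_of_fract_nonzero[of x]
  by (metis Fract_conv_to_fract)

lemma bar_0 [simp]: "bar 0 = 0" and bar_1 [simp]: "bar 1 = 1"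
  by (simp_all add: bar_def)

lemma bar_const: "bar (to_fract [:c:]) = to_fract [:c:]"
  by (simp add: bar_def subst_inv_q_pCons)

lemma bar_q: "bar q = inverse q"
  by (simp add: bar_def q_def subst_inv_q_pCons flip: one_pCons)

lemma bar_add: "bar (x + y) = bar x + bar y"
proof -
  obtain a b where x: "x = to_fract a / to_fract b" "b \<noteq> 0" by (rule ratfun_cases)
  obtain c d where y: "y = to_fract c / to_fract d" "d \<noteq> 0" by (rule ratfun_cases)
  have "x + y = to_fract (a * d + c * b) / to_fract (b * d)"
    using x y by (simp add: field_simps)
  then have "bar (x + y) = subst_inv_q (a * d + c * b) / subst_inv_q (b * d)"
    using x y by (simp only: bar_divide mult_eq_0_iff simp_thms)
  also have "\<dots> = bar x + bar y"
    using x y by (simp add: bar_divide subst_inv_q_add subst_inv_q_mult add_frac_eq)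
  finally show ?thesis .
qed

lemma bar_mult: "bar (x * y) = bar x * bar y"
proof -
  obtain a b where x: "x = to_fract a / to_fract b" "b \<noteq> 0" by (rule ratfun_cases)
  obtain c d where y: "y = to_fract c / to_fract d" "d \<noteq> 0" by (rule ratfun_cases)
  have "x * y = to_fract (a * c) / to_fract (b * d)"
    using x y by simp
  then show ?thesis
    using x y by (simp add: bar_divide subst_inv_q_mult del: to_fract_mult)
qed

lemma pairing_add_left: "pairing (x + y) z = pairing x z + pairing y z"
  by (simp add: pairing_def bar_add algebra_simps sum.distrib)

lemma pairing_scale_left: "pairing (c *s x) y = bar c * pairing x y"
  by (simp add: pairing_def bar_mult sum_distrib_left algebra_simps)

lemma pairing_add_right: "pairing x (y + z) = pairing x y + pairing x z"
  by (simp add: pairing_def algebra_simps sum.distrib)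

lemma pairing_scale_right: "pairing x (c *s y) = c * pairing x y"
  by (simp add: pairing_def sum_distrib_left algebra_simps)

lemma pairing_diff_right: "pairing x (y - z) = pairing x y - pairing x z"
  by (simp add: pairing_def algebra_simps sum_subtractf)

lemma pairing_simple_root: "pairing (simple_root i) (simple_root j) = gram i j"
proof -
  have "pairing (simple_root i) (simple_root j) =
      (\<Sum>k\<in>UNIV. \<Sum>l\<in>UNIV. if k = i then if l = j then gram k l else 0 else 0)"
    unfolding pairing_def simple_root_def axis_def by (intro sum.cong) auto
  also have "\<dots> = (\<Sum>k\<in>UNIV. if k = i then gram k j else 0)"
    by (intro sum.cong) auto
  finally show ?thesis by simp
qed


subsection \<open>The representation is well defined\<close>

lemma linear_burau_gen: "Vector_Spaces.linear (*s) (*s) (burau_gen i)"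
proof (intro Vector_Spaces.linear_iff[THEN iffD2] conjI allI)
  show "burau_gen i (x + y) = burau_gen i x + burau_gen i y" for x y
    by (simp add: burau_gen_def pairing_add_right vec.scale_left_distrib)
  show "burau_gen i (c *s x) = c *s burau_gen i x" for c x
    by (simp add: burau_gen_def pairing_scale_right vec.scale_right_diff_distrib)
qed (rule vec.vector_space_axioms)+

lemma bij_burau_gen: "bij (burau_gen i)"
proof (rule o_bij)
  let ?a = "simple_root i"
  let ?g = "\<lambda>v. v - (inverse q ^ 2 * pairing ?a v) *s ?a"
  show "?g \<circ> burau_gen i = id"
    by (rule ext) (simp add: burau_gen_def pairing_diff_right pairing_scale_right
        pairing_simple_root gram_def vec_eq_iff field_simps)
  show "burau_gen i \<circ> ?g = id"
    by (rule ext) (simp add: burau_gen_def pairing_diff_right pairing_scale_right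
        pairing_simple_root gram_def vec_eq_iff field_simps)
qed

lemma group_GL_V: "group GL_V"
proof (rule groupI)
  show "\<exists>g\<in>carrier GL_V. g \<otimes>\<^bsub>GL_V\<^esub> f = \<one>\<^bsub>GL_V\<^esub>" if f: "f \<in> carrier GL_V" for f
  proof -
    obtain g where "Vector_Spaces.linear (*s) (*s) g" "g \<circ> f = id" "f \<circ> g = id"
      using f vec.linear_injective_isomorphism[of f]
      by (fastforce simp: GL_V_def bij_def fun_eq_iff)
    then show ?thesis
      by (intro bexI[of _ g]) (auto simp: GL_V_def intro: o_bij)
  qed
qed (auto simp: GL_V_def intro: Vector_Spaces.linear_compose vec.linear_id bij_comp)

lemma burau_gen_in_GL_V: "burau_gen i \<in> carrier GL_V"
  by (simp add: GL_V_def linear_burau_gen bij_burau_gen)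

lemma adjacent_sym: "adjacent i j \<longleftrightarrow> adjacent j i"
  by (auto simp: adjacent_def)

lemma adjacent_irrefl: "\<not> adjacent i i"
  by (simp add: adjacent_def)

lemma burau_gen_relations:
  assumes "(u, v) \<in> artin_relations"
  shows "eval_word GL_V burau_gen u = eval_word GL_V burau_gen v"
proof -
  have braid: "burau_gen i (burau_gen j (burau_gen i x)) = burau_gen j (burau_gen i (burau_gen j x))"
    if "adjacent i j" for i j x
  proof -
    have "i \<noteq> j" "adjacent j i" using that adjacent_irrefl adjacent_sym by blast+
    then show ?thesis using that
      by (simp add: burau_gen_def pairing_diff_right pairing_scale_right pairing_simple_root
          gram_def vec_eq_iff) (simp add: algebra_simps power2_eq_square)
  qed
  have comm: "burau_gen i (burau_gen j x) = burau_gen j (burau_gen i x)"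
    if "i \<noteq> j" "\<not> adjacent i j" for i j x
    using that adjacent_sym[of i j]
    by (simp add: burau_gen_def pairing_diff_right pairing_scale_right pairing_simple_root gram_def)
  show ?thesis using assms
    by (auto simp: artin_relations_def eval_word_def eval_letter_def GL_V_def fun_eq_iff
        intro: braid comm)
qed

lemma group_artin_group: "group artin_group"
  unfolding artin_group_def by (rule group_presented_group)

lemma burau_artin_gen: "burau (artin_gen i) = burau_gen i"
  unfolding burau_def artin_gen_def
  by (intro group.pres_lift_hom(2) group_GL_V burau_gen_in_GL_V burau_gen_relations)

lemma burau_artin_gen_simple_root:
  "burau (artin_gen i) (simple_root j) = simple_root j - gram i j *s simple_root i"
  by (simp add: burau_artin_gen burau_gen_def pairing_simple_root)

lemma burau_hom: "group_hom artin_group GL_V burau"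
  unfolding burau_def artin_group_def
  by (intro group_hom.intro group_hom_axioms.intro group_presented_group group_GL_V
      group.pres_lift_hom(1) burau_gen_in_GL_V burau_gen_relations)

end

theory Submission
  imports Defs
begin

text \<open>
  An element \<open>w\<close> with \<open>w \<alpha>\<^sub>1 = q\<^sup>4 \<alpha>\<^sub>1\<close> in the Burau representation commutes with \<open>\<sigma>\<^sub>1\<close> there, because
  the pairing is invariant and \<open>\<sigma>\<^sub>1\<close> is the reflection in \<open>\<alpha>\<^sub>1\<close>. For the word \<open>w\<close> below, of length
  18, it does not commute with \<open>\<sigma>\<^sub>1\<close> in the group: the diagram is a cycle, so the Burau
  representation has a deformation in which the edge joining the vertices 4 and 1 is multiplied by a
  scalar \<open>t\<close> in one direction and by \<open>t\<inverse>\<close> in the other, and at \<open>t = -1\<close>, \<open>q = 2\<close> the vector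
  \<open>w \<alpha>\<^sub>1\<close> is not a multiple of \<open>\<alpha>\<^sub>1\<close>. Hence the commutator of \<open>w\<close> and \<open>\<sigma>\<^sub>1\<close> is a non-trivial element of
  the kernel.
\<close>

section \<open>Reflection-type actions of words, tested on the relations\<close>

lemma pres_eq_foldr_eq:
  assumes "\<And>g b x. \<rho> (g, b) (\<rho> (g, \<not> b) x) = x"
    and "\<And>u v. (u, v) \<in> R \<Longrightarrow> foldr \<rho> u = foldr \<rho> v"
    and "pres_eq R u v"
  shows "foldr \<rho> u = foldr \<rho> v"
  using assms(3) by induction (simp_all add: assms(1,2) foldr_append fun_eq_iff)

definition row_form :: "('n::finite \<Rightarrow> 'n \<Rightarrow> 'a::field) \<Rightarrow> 'n \<Rightarrow> 'a ^ 'n \<Rightarrow> 'a" where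
  "row_form h i v = (\<Sum>j\<in>UNIV. h i j * v $ j)"

text \<open>With \<open>h i i = 1 + s\<close>, a positive letter acts by T with (T - 1)(T + s) = 0,
  so its inverse is 1 + (T - 1)/s; hence the factor \<open>inverse s\<close>. Different
  \<open>h\<close> give both the Burau action and its twist.\<close>

definition hecke_letter ::
  "('n::finite \<Rightarrow> 'n \<Rightarrow> 'a::field) \<Rightarrow> 'a \<Rightarrow> 'n \<times> bool \<Rightarrow> 'a ^ 'n \<Rightarrow> 'a ^ 'n" where
  "hecke_letter h s l v =
     v - ((if snd l then 1 else inverse s) * row_form h (fst l) v) *s axis (fst l) 1"

lemma row_form_diff_axis:
  "row_form h i (v - c *s axis j 1) = row_form h i v - c * h i j"
proof -
  have "h i k * (v - c *s axis j 1) $ k = h i k * v $ k - (if k = j then c * h i j else 0)" for k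
    by (simp add: axis_def algebra_simps)
  then show ?thesis by (simp add: row_form_def sum_subtractf)
qed

lemma hecke_letter_inverse:
  assumes "s \<noteq> 0" "h i i = 1 + s"
  shows "hecke_letter h s (i, b) (hecke_letter h s (i, \<not> b) v) = v"
  using assms by (cases b)
    (simp_all add: hecke_letter_def row_form_diff_axis vec_eq_iff field_simps)

text \<open>For a = \<open>row_form h i v\<close> and b = \<open>row_form h j v\<close>, both sides
  reduce to v - (a - b \<open>h i j\<close>) e_i - (b - a \<open>h j i\<close>) e_j, which is
  symmetric in i and j. Only the product of the two off-diagonal entries matters, which leaves room
  for the twist.\<close>

lemma hecke_letter_braid:
  assumes "h i i = 1 + s" "h j j = 1 + s" "h i j * h j i = s"
  shows "hecke_letter h s (i, True) (hecke_letter h s (j, True) (hecke_letter h s (i, True) v)) =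
    hecke_letter h s (j, True) (hecke_letter h s (i, True) (hecke_letter h s (j, True) v))"
  using assms(1,2)
  by (simp add: hecke_letter_def row_form_diff_axis vec_eq_iff flip: assms(3))
    (simp add: algebra_simps)

lemma hecke_letter_commute:
  assumes "h i j = 0" "h j i = 0"
  shows "hecke_letter h s (i, True) (hecke_letter h s (j, True) v) =
    hecke_letter h s (j, True) (hecke_letter h s (i, True) v)"
  using assms by (simp add: hecke_letter_def row_form_diff_axis)

lemma foldr_hecke_letter_artin:
  assumes "s \<noteq> 0" "\<And>i. h i i = 1 + s"
    and "\<And>i j. adjacent i j \<Longrightarrow> h i j * h j i = s"
    and "\<And>i j. i \<noteq> j \<Longrightarrow> \<not> adjacent i j \<Longrightarrow> h i j = 0"
    and "pres_eq artin_relations u v"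
  shows "foldr (hecke_letter h s) u = foldr (hecke_letter h s) v"
proof (rule pres_eq_foldr_eq[OF _ _ assms(5)])
  show "hecke_letter h s (i, b) (hecke_letter h s (i, \<not> b) x) = x" for i b x
    by (intro hecke_letter_inverse assms)
  show "foldr (hecke_letter h s) u = foldr (hecke_letter h s) v"
    if "(u, v) \<in> artin_relations" for u v
    using that assms(2-4) adjacent_sym
    by (auto simp: artin_relations_def fun_eq_iff intro!: hecke_letter_braid hecke_letter_commute)
qed

section \<open>Non-commutation in the twisted action\<close>

lemma vector_4:
  "(vector [a, b, c, d] :: 'a::zero ^ 4) $ 1 = a"
  "(vector [a, b, c, d] :: 'a ^ 4) $ 2 = b"
  "(vector [a, b, c, d] :: 'a ^ 4) $ 3 = c"
  "(vector [a, b, c, d] :: 'a ^ 4) $ 4 = d"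
  unfolding vector_def by simp_all

lemma hecke_letter_vector_4:
  fixes h :: "4 \<Rightarrow> 4 \<Rightarrow> 'a::field" and s :: 'a
  defines "k \<equiv> \<lambda>i z a b c d. (if z then 1 else inverse s) *
    (h i 1 * a + h i 2 * b + h i 3 * c + h i 4 * d)"
  shows "hecke_letter h s (1, z) (vector [a, b, c, d]) = vector [a - k 1 z a b c d, b, c, d]"
    "hecke_letter h s (2, z) (vector [a, b, c, d]) = vector [a, b - k 2 z a b c d, c, d]"
    "hecke_letter h s (3, z) (vector [a, b, c, d]) = vector [a, b, c - k 3 z a b c d, d]"
    "hecke_letter h s (4, z) (vector [a, b, c, d]) = vector [a, b, c, d - k 4 z a b c d]"
  by (simp_all add: hecke_letter_def row_form_def k_def vec_eq_iff forall_4 sum_4 vector_4 axis_def)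

text \<open>The Gram matrix at \<open>q = 2\<close>, with the sign of one edge of the cycle changed.\<close>

definition twisted_gram :: "4 \<Rightarrow> 4 \<Rightarrow> rat" where
  "twisted_gram i j =
     (if i = j then 5 else if {i, j} = {4, 1} then - 2 else if adjacent i j then 2 else 0)"

text \<open>
  The word is \<open>v\<inverse>u\<close> with \<open>u = \<sigma>\<^sub>2\<inverse>\<sigma>\<^sub>1\<sigma>\<^sub>4\<sigma>\<^sub>3\<sigma>\<^sub>2\<sigma>\<^sub>1\<sigma>\<^sub>4\<sigma>\<^sub>3\<sigma>\<^sub>2\<close> and
  \<open>v = \<sigma>\<^sub>2\<sigma>\<^sub>1\<sigma>\<^sub>4\<sigma>\<^sub>3\<inverse>\<sigma>\<^sub>2\<sigma>\<^sub>1\<sigma>\<^sub>4\<inverse>\<sigma>\<^sub>3\<sigma>\<^sub>2\<close>, found by a computer search for words such that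
  \<open>u \<alpha>\<^sub>1\<close> and \<open>v \<alpha>\<^sub>1\<close> are proportional.
\<close>

definition stab_word :: "4 word" where
  "stab_word =
     [(2, False), (3, False), (4, True), (1, False), (2, False), (3, True), (4, False),
      (1, False), (2, False), (2, False), (1, True), (4, True), (3, True), (2, True),
      (1, True), (4, True), (3, True), (2, True)]"

lemma adjacent_simps:
  "adjacent 1 2" "adjacent 2 1" "adjacent 2 3" "adjacent 3 2" "adjacent 3 4" "adjacent 4 3"
  "adjacent 4 1" "adjacent 1 4" "\<not> adjacent 1 3" "\<not> adjacent 3 1" "\<not> adjacent 2 4" "\<not> adjacent 4 2"
  by (simp_all add: adjacent_def)

lemma stab_word_not_commute:
  "\<not> pres_eq artin_relations (stab_word @ [(1, True)]) ([(1, True)] @ stab_word)"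
proof
  let ?H = "hecke_letter twisted_gram 4"
  assume "pres_eq artin_relations (stab_word @ [(1, True)]) ([(1, True)] @ stab_word)"
  then have "foldr ?H (stab_word @ [(1, True)]) = foldr ?H ([(1, True)] @ stab_word)"
  proof (rule foldr_hecke_letter_artin[rotated -1])
    show "twisted_gram i j * twisted_gram j i = 4" if "adjacent i j" for i j
      using that adjacent_irrefl adjacent_sym by (auto simp: twisted_gram_def)
    show "twisted_gram i j = 0" if "i \<noteq> j" "\<not> adjacent i j" for i j
      using that adjacent_simps by (auto simp: twisted_gram_def doubleton_eq_iff)
  qed (simp_all add: twisted_gram_def)
  \<comment> \<open>Here the generator 1 scales e_1 by -4 and leaves coordinate 2 unchanged, so
    equality would force coordinate 2 of w e_1 to vanish.\<close>
  then have "foldr ?H (stab_word @ [(1, True)]) (vector [1, 0, 0, 0]) $ 2 =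
      foldr ?H ([(1, True)] @ stab_word) (vector [1, 0, 0, 0]) $ 2"
    by simp
  then show False
    by (simp add: stab_word_def hecke_letter_vector_4 twisted_gram_def adjacent_simps
        doubleton_eq_iff vector_4)
qed

section \<open>Unitarity of the Burau representation\<close>

lemma pairing_simple_root_left: "pairing (simple_root i) v = row_form gram i v"
proof -
  have "pairing (simple_root i) v =
      (\<Sum>k\<in>UNIV. \<Sum>j\<in>UNIV. if k = i then gram k j * v $ j else 0)"
    unfolding pairing_def simple_root_def axis_def by (intro sum.cong) auto
  also have "\<dots> = (\<Sum>k\<in>UNIV. if k = i then \<Sum>j\<in>UNIV. gram k j * v $ j else 0)"
    by (intro sum.cong) auto
  finally show ?thesis by (simp add: row_form_def)
qed

lemma burau_gen_eq_hecke_letter: "burau_gen i = hecke_letter gram (q\<^sup>2) (i, True)"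
  by (simp add: fun_eq_iff burau_gen_def hecke_letter_def pairing_simple_root_left)
    (simp add: simple_root_def)

lemma eval_letter_burau: "eval_letter GL_V burau_gen l = hecke_letter gram (q\<^sup>2) l"
proof -
  interpret GL: group GL_V by (rule group_GL_V)
  obtain i b where l: "l = (i, b)" by force
  show ?thesis
  proof (cases b)
    case True
    then show ?thesis by (simp add: l eval_letter_def burau_gen_eq_hecke_letter)
  next
    case False
    let ?g = "hecke_letter gram (q\<^sup>2) (i, False)"
    have "inv\<^bsub>GL_V\<^esub> (burau_gen i) \<otimes>\<^bsub>GL_V\<^esub> burau_gen i = \<one>\<^bsub>GL_V\<^esub>"
      by (rule GL.l_inv[OF burau_gen_in_GL_V])
    then have *: "(inv\<^bsub>GL_V\<^esub> (burau_gen i)) (burau_gen i x) = x" for x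
      by (simp add: GL_V_def fun_eq_iff)
    have "burau_gen i (?g x) = x" for x
      using hecke_letter_inverse[of "q\<^sup>2" gram i True x]
      by (simp add: burau_gen_eq_hecke_letter gram_def)
    then have "(inv\<^bsub>GL_V\<^esub> (burau_gen i)) x = ?g x" for x
      using *[of "?g x"] by simp
    then show ?thesis by (simp add: l False eval_letter_def fun_eq_iff)
  qed
qed

lemma eval_word_burau: "eval_word GL_V burau_gen u = foldr (hecke_letter gram (q\<^sup>2)) u"
  by (induction u) (simp_all add: eval_word_def eval_letter_burau, simp_all add: GL_V_def fun_eq_iff)

lemma burau_word_class: "burau (word_class artin_relations u) = foldr (hecke_letter gram (q\<^sup>2)) u"
  unfolding burau_def eval_word_burau[symmetric]
  by (intro group.pres_lift_word_class group_GL_V burau_gen_in_GL_V burau_gen_relations)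

text \<open>Since \<open>bar\<close> sends 1 + q^2 to q^-2 (1 + q^2) and q to q^-2 q, the pairing
  divided by q is hermitian.\<close>

lemma bar_pairing_simple_root:
  "bar (pairing (simple_root i) x) = inverse (q\<^sup>2) * pairing x (simple_root i)"
proof -
  have bar_gram: "bar (gram i j) = inverse (q\<^sup>2) * gram j i" for j
    using adjacent_sym[of i j]
    by (auto simp: gram_def bar_add bar_mult bar_q power2_eq_square field_simps)
  have "pairing x (simple_root i) = (\<Sum>j\<in>UNIV. bar (x $ j) * gram j i)"
  proof -
    have "pairing x (simple_root i) =
      (\<Sum>j\<in>UNIV. \<Sum>k\<in>UNIV. if k = i then bar (x $ j) * gram j k else 0)"
      unfolding pairing_def simple_root_def axis_def by (intro sum.cong) auto
    then show ?thesis by simp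
  qed
  then show ?thesis
    by (simp add: pairing_simple_root_left row_form_def sum_4 bar_add bar_mult bar_gram algebra_simps)
qed

lemma pairing_diff_left: "pairing (x - y) z = pairing x z - pairing y z"
  using pairing_add_left[of "x - y" y z] by simp

text \<open>Let a and b be the pairings of \<alpha>_i with x and y. The correction terms are -q^2
  \<open>bar a\<close> b, -\<open>bar a\<close> b and (1 + q^2) \<open>bar a\<close> b, which
  cancel.\<close>

lemma pairing_burau_gen: "pairing (burau_gen i x) (burau_gen i y) = pairing x y"
  by (simp add: burau_gen_def pairing_diff_left pairing_diff_right pairing_scale_left
      pairing_scale_right pairing_simple_root bar_pairing_simple_root gram_def field_simps)

lemma pairing_hecke_letter:
  "pairing (hecke_letter gram (q\<^sup>2) l x) (hecke_letter gram (q\<^sup>2) l y) = pairing x y"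
proof -
  obtain i b where l: "l = (i, b)" by force
  show ?thesis
  proof (cases b)
    case True
    then show ?thesis using pairing_burau_gen by (simp add: l burau_gen_eq_hecke_letter)
  next
    case False
    have "burau_gen i (hecke_letter gram (q\<^sup>2) l z) = z" for z
      using hecke_letter_inverse[of "q\<^sup>2" gram i True z]
      by (simp add: burau_gen_eq_hecke_letter gram_def l False)
    then show ?thesis
      using pairing_burau_gen[of i "hecke_letter gram (q\<^sup>2) l x" "hecke_letter gram (q\<^sup>2) l y"]
      by simp
  qed
qed

lemma pairing_foldr_hecke_letter:
  "pairing (foldr (hecke_letter gram (q\<^sup>2)) u x) (foldr (hecke_letter gram (q\<^sup>2)) u y) = pairing x y"
  by (induction u) (simp_all add: pairing_hecke_letter)

section \<open>The word w in the Burau representation\<close>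

lemma stab_word_simple_root:
  "foldr (hecke_letter gram (q\<^sup>2)) stab_word (simple_root 1) = q ^ 4 *s simple_root 1"
proof -
  let ?H = "hecke_letter gram (q\<^sup>2)"
  have ends: "simple_root 1 = vector [1, 0, 0, 0]" "q ^ 4 *s simple_root 1 = vector [q ^ 4, 0, 0, 0]"
    by (simp_all add: simple_root_def axis_def vec_eq_iff forall_4 vector_4)
  note simps = hecke_letter_vector_4 gram_def adjacent_simps
  let ?a = "q ^ 4 + q ^ 6 + q ^ 8" and ?c = "q ^ 2 + q ^ 4 + q ^ 6"
    and ?d = "- (q ^ 3 + q ^ 5 + q ^ 7)"
  \<comment> \<open>One equation per letter, starting from the right end of the word; each changes a
    single coordinate. The ninth result is u \<alpha>_1, and the other nine letters are those of the
    inverse of v.\<close>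
  have steps:
    "?H (2, True) (vector [1, 0, 0, 0]) =
      vector [1, - q, 0, 0]"
    "?H (3, True) (vector [1, - q, 0, 0]) =
      vector [1, - q, q ^ 2, 0]"
    "?H (4, True) (vector [1, - q, q ^ 2, 0]) =
      vector [1, - q, q ^ 2, - (q + q ^ 3)]"
    "?H (1, True) (vector [1, - q, q ^ 2, - (q + q ^ 3)]) =
      vector [q ^ 2 + q ^ 4, - q, q ^ 2, - (q + q ^ 3)]"
    "?H (2, True) (vector [q ^ 2 + q ^ 4, - q, q ^ 2, - (q + q ^ 3)]) =
      vector [q ^ 2 + q ^ 4, - (q ^ 3 + q ^ 5), q ^ 2, - (q + q ^ 3)]"
    "?H (3, True) (vector [q ^ 2 + q ^ 4, - (q ^ 3 + q ^ 5), q ^ 2, - (q + q ^ 3)]) =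
      vector [q ^ 2 + q ^ 4, - (q ^ 3 + q ^ 5), ?c, - (q + q ^ 3)]"
    "?H (4, True) (vector [q ^ 2 + q ^ 4, - (q ^ 3 + q ^ 5), ?c, - (q + q ^ 3)]) =
      vector [q ^ 2 + q ^ 4, - (q ^ 3 + q ^ 5), ?c, ?d]"
    "?H (1, True) (vector [q ^ 2 + q ^ 4, - (q ^ 3 + q ^ 5), ?c, ?d]) =
      vector [?a, - (q ^ 3 + q ^ 5), ?c, ?d]"
    "?H (2, False) (vector [?a, - (q ^ 3 + q ^ 5), ?c, ?d]) =
      vector [?a, - (q ^ 3 + 2 * q ^ 5 + q ^ 7), ?c, ?d]"
    "?H (2, False) (vector [?a, - (q ^ 3 + 2 * q ^ 5 + q ^ 7), ?c, ?d]) =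
      vector [?a, - (q ^ 5 + q ^ 7), ?c, ?d]"
    "?H (1, False) (vector [?a, - (q ^ 5 + q ^ 7), ?c, ?d]) =
      vector [q ^ 4 + q ^ 6, - (q ^ 5 + q ^ 7), ?c, ?d]"
    "?H (4, False) (vector [q ^ 4 + q ^ 6, - (q ^ 5 + q ^ 7), ?c, ?d]) =
      vector [q ^ 4 + q ^ 6, - (q ^ 5 + q ^ 7), ?c, - (q ^ 3 + q ^ 5)]"
    "?H (3, True) (vector [q ^ 4 + q ^ 6, - (q ^ 5 + q ^ 7), ?c, - (q ^ 3 + q ^ 5)]) =
      vector [q ^ 4 + q ^ 6, - (q ^ 5 + q ^ 7), q ^ 6, - (q ^ 3 + q ^ 5)]"
    "?H (2, False) (vector [q ^ 4 + q ^ 6, - (q ^ 5 + q ^ 7), q ^ 6, - (q ^ 3 + q ^ 5)]) =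
      vector [q ^ 4 + q ^ 6, - (q ^ 5), q ^ 6, - (q ^ 3 + q ^ 5)]"
    "?H (1, False) (vector [q ^ 4 + q ^ 6, - (q ^ 5), q ^ 6, - (q ^ 3 + q ^ 5)]) =
      vector [q ^ 4, - (q ^ 5), q ^ 6, - (q ^ 3 + q ^ 5)]"
    "?H (4, True) (vector [q ^ 4, - (q ^ 5), q ^ 6, - (q ^ 3 + q ^ 5)]) =
      vector [q ^ 4, - (q ^ 5), q ^ 6, 0]"
    "?H (3, False) (vector [q ^ 4, - (q ^ 5), q ^ 6, 0]) =
      vector [q ^ 4, - (q ^ 5), 0, 0]"
    "?H (2, False) (vector [q ^ 4, - (q ^ 5), 0, 0]) =
      vector [q ^ 4, 0, 0, 0]"
    by (simp_all add: simps vec_eq_iff forall_4 vector_4 eval_nat_numeral field_simps)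
  show ?thesis
    \<comment> \<open>\<open>ends(1)\<close> would also rewrite the root inside q^4 \<alpha>_1, so
      \<open>ends(2)\<close> goes first.\<close>
    unfolding ends(2) unfolding ends(1)
    by (simp only: stab_word_def foldr.simps comp_apply id_apply steps)
qed

lemma burau_stab_word_commute:
  "burau (word_class artin_relations stab_word) \<circ> burau (artin_gen 1) =
    burau (artin_gen 1) \<circ> burau (word_class artin_relations stab_word)"
proof
  fix v
  let ?f = "foldr (hecke_letter gram (q\<^sup>2)) stab_word"
  let ?a = "simple_root 1"
  have "word_class artin_relations stab_word \<in> carrier artin_group"
    by (simp add: artin_group_def presented_group_def)
  from group_hom.hom_closed[OF burau_hom this]
  have linear: "Vector_Spaces.linear (*s) (*s) ?f"
    by (simp add: GL_V_def burau_word_class)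
  \<comment> \<open>By sesquilinearity the eigenvalue q^4 leaves the left slot as q^-4; this
    compensates the q^4 that \<open>?f\<close> puts on \<alpha>_1 in the reflection formula.\<close>
  have "pairing ?a v = pairing (q ^ 4 *s ?a) (?f v)"
    using pairing_foldr_hecke_letter[of stab_word ?a v] by (simp add: stab_word_simple_root)
  also have "\<dots> = inverse q ^ 4 * pairing ?a (?f v)"
    by (simp add: pairing_scale_left bar_mult bar_q power4_eq_xxxx)
  finally have "pairing ?a v * q ^ 4 = pairing ?a (?f v)"
    by (simp add: field_simps)
  moreover have "?f (v - pairing ?a v *s ?a) = ?f v - pairing ?a v *s (q ^ 4 *s ?a)"
    using linear by (simp add: vec.linear_diff vec.linear_scale stab_word_simple_root)
  ultimately have "?f (burau_gen 1 v) = burau_gen 1 (?f v)"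
    by (simp add: burau_gen_def vector_smult_assoc)
  then show "(burau (word_class artin_relations stab_word) \<circ> burau (artin_gen 1)) v =
      (burau (artin_gen 1) \<circ> burau (word_class artin_relations stab_word)) v"
    by (simp add: burau_word_class burau_artin_gen)
qed

theorem theorem4p1:
  shows "kernel artin_group GL_V burau \<noteq> {\<one>\<^bsub>artin_group\<^esub>}"
proof
  assume trivial: "kernel artin_group GL_V burau = {\<one>\<^bsub>artin_group\<^esub>}"
  interpret group_hom artin_group GL_V burau by (rule burau_hom)
  let ?w = "word_class artin_relations stab_word"
  let ?s = "artin_gen 1"
  have carrier: "?w \<in> carrier artin_group" "?s \<in> carrier artin_group"
    by (simp_all add: artin_group_def artin_gen_def pres_gen_def presented_group_def)
  have "burau (?w \<otimes>\<^bsub>artin_group\<^esub> ?s) = burau (?s \<otimes>\<^bsub>artin_group\<^esub> ?w)"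
    using carrier burau_stab_word_commute by (simp add: GL_V_def)
  moreover have "inj_on burau (carrier artin_group)"
    using trivial by (rule trivial_ker_imp_inj)
  ultimately have "?w \<otimes>\<^bsub>artin_group\<^esub> ?s = ?s \<otimes>\<^bsub>artin_group\<^esub> ?w"
    using carrier by (meson G.m_closed inj_onD)
  then have "pres_eq artin_relations (stab_word @ [(1, True)]) ([(1, True)] @ stab_word)"
    unfolding artin_group_def artin_gen_def pres_gen_def mult_word_class word_class_eq_iff .
  then show False using stab_word_not_commute by contradiction
qed

end
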